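(* Let $n$ and $k$ be non-negative integers with $0\le k\le n$. Then \[ \frac {1-q^{\gcd(k,n)}} {1-q^n}\begin{bmatrix} 2n\\ n-k\end{bmatrix}_q \] is a polynomial in $q$ with non-negative integer coefficients. Consequently, also $B_{n,k}(q)=\frac{1-q^k}{1-q^n}\begin{bmatrix} 2n\\ n-k\end{bmatrix}_q$ is a polynomial with non-negative coefficients.
   Context: The $q$-binomial coefficients (Gaussian polynomials) are defined by $\begin{bmatrix} n\\ k\end{bmatrix}_q=\frac{(1-q^n)(1-q^{n-1})\cdots(1-q)}{(1-q^k)(1-q^{k-1})\cdots(1-q)(1-q^{n-k})(1-q^{n-k-1})\cdots(1-q)}$ if $0\le k\le n$, and $0$ otherwise. For $1\le k\le n$, $B_{n,k}(q):=\frac{1-q^k}{1-q^n}\begin{bmatrix} 2n\\ n-k\end{bmatrix}_q=\begin{bmatrix} 2n-1\\ n-k\end{bmatrix}_q-\begin{bmatrix} 2n-1\\ n-k-1\end{bmatrix}_q q^k$ (introduced by Guo and Zeng). *)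

theory Defs
  imports "HOL-Computational_Algebra.Polynomial_Factorial"
begin

text \<open>
  The variable \<open>q\<close> is an indeterminate: all quotients are formed in the field of fractions of
  \<open>\<int>[q]\<close>, i.e. in the field \<open>\<rat>(q)\<close> of rational functions.
\<close>

definition qvar :: "int poly fract" where
  "qvar = to_fract [:0, 1:]"

definition qbinomial :: "nat \<Rightarrow> nat \<Rightarrow> int poly fract" where
  "qbinomial n k =
     (if k \<le> n
      then (\<Prod>i = 1..n. 1 - qvar ^ i) /
           ((\<Prod>i = 1..k. 1 - qvar ^ i) * (\<Prod>i = 1..n - k. 1 - qvar ^ i))
      else 0)"

text \<open>Meaningful for \<open>k \<le> n\<close> only, since \<open>n - k\<close> is a truncated subtraction.\<close>

definition qB :: "nat \<Rightarrow> nat \<Rightarrow> int poly fract" where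
  "qB n k = (1 - qvar ^ k) / (1 - qvar ^ n) * qbinomial (2 * n) (n - k)"

definition nonneg_int_polynomial :: "int poly fract \<Rightarrow> bool" where
  "nonneg_int_polynomial f \<longleftrightarrow>
     (\<exists>p :: int poly. (\<forall>i. 0 \<le> coeff p i) \<and> f = to_fract p)"

end

theory Submission
  imports Defs Complex_Main
begin

text \<open>
  The Gaussian polynomial \<open>p\<close> of \<open>2n\<close> over \<open>n - k\<close> is palindromic of some degree \<open>N\<close> and unimodal, so
  for \<open>e > 0\<close> the coefficients of \<open>(1 - q\<^sup>e) p\<close> are non-negative up to index \<open>(N + e) / 2\<close>. If
  \<open>1 - q\<^sup>n\<close> divides \<open>(1 - q\<^sup>e) p\<close>, the quotient inherits this, as dividing means multiplying by
  \<open>1 + q\<^sup>n + q\<^sup>2\<^sup>n + \<dots>\<close>; being palindromic of degree \<open>N + e - n\<close>, it has only non-negative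
  coefficients. Divisibility for \<open>e = k\<close> is the expression of \<open>B\<^sub>n\<^sub>,\<^sub>k\<close> as a difference of Gaussian
  polynomials, and for \<open>e = gcd k n\<close> it follows by Bezout's identity.

  Unimodality comes from the action of \<open>sl\<^sub>2\<close> on the \<open>m\<close>-th exterior power of its irreducible
  \<open>M\<close>-dimensional representation, whose basis is indexed by the \<open>m\<close>-subsets of \<open>{0, \<dots>, M - 1}\<close>,
  graded by their sum. For the raising operator \<open>U\<close> and its adjoint \<open>D\<close>, the commutator \<open>DU - UD\<close> is
  a positive scalar below the middle degree, so \<open>\<parallel>Uf\<parallel>\<^sup>2 = \<parallel>Df\<parallel>\<^sup>2 + c \<parallel>f\<parallel>\<^sup>2\<close> with \<open>c > 0\<close> and
  \<open>U\<close> is injective there.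
\<close>

section \<open>Unimodality of the number of subsets with given size and sum\<close>

text \<open>More unknowns than equations: the functionals \<open>L b\<close> are eliminated one at a
  time, each costing one point of the support \<open>A\<close>.\<close>

lemma exists_nonzero_in_kernel:
  fixes L :: "'b \<Rightarrow> ('a \<Rightarrow> real) \<Rightarrow> real"
  assumes "finite B" and "finite A" and "card B < card A"
    and "\<And>b f g c. L b (\<lambda>x. f x + c * g x) = L b f + c * L b g"
  shows "\<exists>f. (\<exists>x\<in>A. f x \<noteq> 0) \<and> (\<forall>x. x \<notin> A \<longrightarrow> f x = 0) \<and> (\<forall>b\<in>B. L b f = 0)"
  using assms(1-3)
proof (induction B arbitrary: A rule: finite_induct)
  case empty
  then obtain a where "a \<in> A" by fastforce
  then show ?case by (intro exI[of _ "\<lambda>x. if x = a then 1 else 0"]) auto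
next
  case (insert b B)
  from insert.IH[of A] insert.prems insert.hyps obtain f1 where
    f1: "\<exists>x\<in>A. f1 x \<noteq> 0" "\<forall>x. x \<notin> A \<longrightarrow> f1 x = 0" "\<forall>b\<in>B. L b f1 = 0" by auto
  then obtain x where x: "x \<in> A" "f1 x \<noteq> 0" by auto
  have "card B < card (A - {x})" using insert.prems insert.hyps x by simp
  from insert.IH[OF _ this] insert.prems obtain f2 where
    f2: "\<exists>y\<in>A - {x}. f2 y \<noteq> 0" "\<forall>y. y \<notin> A - {x} \<longrightarrow> f2 y = 0" "\<forall>b\<in>B. L b f2 = 0" by auto
  show ?case
  proof (cases "L b f2 = 0")
    case True
    then show ?thesis using f2 by (intro exI[of _ f2]) auto
  next
    case False
    \<comment> \<open>Since \<open>f2\<close> vanishes at \<open>x\<close>, cancelling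
      \<open>L b\<close> with a multiple of \<open>f2\<close> leaves the value \<open>f1 x\<close>
      intact.\<close>
    let ?f = "\<lambda>y. f1 y + (- (L b f1 / L b f2)) * f2 y"
    have "?f x \<noteq> 0" using f2(2) x by simp
    moreover have "?f y = 0" if "y \<notin> A" for y using f1(2) f2(2) that by simp
    moreover have "L b' ?f = 0" if "b' \<in> insert b B" for b'
      unfolding assms(4) using that f1(3) f2(3) False by auto
    ultimately show ?thesis using x(1) by (intro exI[of _ ?f]) auto
  qed
qed

section \<open>Operators that move one element of a subset by one\<close>

definition raise_at :: "(nat \<Rightarrow> real) \<Rightarrow> nat \<Rightarrow> (nat set \<Rightarrow> real) \<Rightarrow> nat set \<Rightarrow> real" where
  "raise_at w s f T =
     (if Suc s \<in> T \<and> s \<notin> T then w s * f (insert s (T - {Suc s})) else 0)"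

text \<open>Functions serve as coordinate vectors, so the operator reads \<open>f\<close> at the set
  that turns into \<open>T\<close> when \<open>Suc s\<close> moves down to \<open>s\<close>. Only
  neighbours are exchanged, which keeps the elements in order, so no signs of the exterior power
  appear.\<close>

definition lower_at :: "(nat \<Rightarrow> real) \<Rightarrow> nat \<Rightarrow> (nat set \<Rightarrow> real) \<Rightarrow> nat set \<Rightarrow> real" where
  "lower_at w s f T =
     (if s \<in> T \<and> Suc s \<notin> T then w s * f (insert (Suc s) (T - {s})) else 0)"

text \<open>If the pairs \<open>s\<close>, \<open>Suc s\<close> and \<open>t\<close>,
  \<open>Suc t\<close> overlap, both sides vanish, because one move leaves the shared index in the
  state that blocks the other. Disjoint pairs do not interact.\<close>

lemma raise_at_lower_at_commute:
  assumes "s \<noteq> t"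
  shows "raise_at w s (lower_at w t f) T = lower_at w t (raise_at w s f) T"
proof -
  have "insert (Suc t) (insert s (T - {Suc s}) - {t}) = insert s (insert (Suc t) (T - {t}) - {Suc s})"
    if "s \<notin> T" "t \<in> T" using assms that by auto
  then show ?thesis
    using assms by (auto simp: raise_at_def lower_at_def)
qed

lemma raise_at_lower_at_same:
  "raise_at w s (lower_at w s f) T = (if Suc s \<in> T \<and> s \<notin> T then (w s)\<^sup>2 * f T else 0)"
proof -
  have "insert (Suc s) (insert s (T - {Suc s}) - {s}) = T" if "Suc s \<in> T" "s \<notin> T"
    using that by auto
  then show ?thesis by (auto simp: raise_at_def lower_at_def power2_eq_square)
qed

lemma lower_at_raise_at_same:
  "lower_at w s (raise_at w s f) T = (if s \<in> T \<and> Suc s \<notin> T then (w s)\<^sup>2 * f T else 0)"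
proof -
  have "insert s (insert (Suc s) (T - {s}) - {Suc s}) = T" if "s \<in> T" "Suc s \<notin> T"
    using that by auto
  then show ?thesis by (auto simp: raise_at_def lower_at_def power2_eq_square)
qed

text \<open>Replacing \<open>Suc s\<close> by \<open>s\<close> is a bijection between the sets on
  which the two summands can be nonzero.\<close>

lemma raise_at_adjoint:
  assumes "Suc s < M"
  shows "(\<Sum>T\<in>Pow {..<M}. raise_at w s f T * g T) = (\<Sum>T\<in>Pow {..<M}. f T * lower_at w s g T)"
proof -
  let ?P = "{T \<in> Pow {..<M}. Suc s \<in> T \<and> s \<notin> T}"
  let ?Q = "{T \<in> Pow {..<M}. s \<in> T \<and> Suc s \<notin> T}"
  have "(\<Sum>T\<in>Pow {..<M}. raise_at w s f T * g T)
      = (\<Sum>T\<in>?P. w s * f (insert s (T - {Suc s})) * g T)"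
    by (rule sum.mono_neutral_cong_right) (auto simp: raise_at_def)
  also have "\<dots> = (\<Sum>T\<in>?Q. w s * f T * g (insert (Suc s) (T - {s})))"
    using assms
    by (intro sum.reindex_bij_witness[of _ "\<lambda>T. insert (Suc s) (T - {s})" "\<lambda>T. insert s (T - {Suc s})"])
      (auto intro!: arg_cong[of _ _ g])
  also have "\<dots> = (\<Sum>T\<in>Pow {..<M}. f T * lower_at w s g T)"
    by (rule sum.mono_neutral_cong_left) (auto simp: lower_at_def)
  finally show ?thesis .
qed

text \<open>Adjointness turns the difference of the expanded squares into commutators of single
  moves. Those with distinct indices vanish, and the diagonal ones act as scalars on each
  coordinate.\<close>

lemma norm_raise_minus_norm_lower:
  fixes f :: "nat set \<Rightarrow> real"
  shows "(\<Sum>T\<in>Pow {..<M}. (\<Sum>s<M-1. raise_at w s f T)\<^sup>2)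
       = (\<Sum>T\<in>Pow {..<M}. (\<Sum>s<M-1. lower_at w s f T)\<^sup>2)
       + (\<Sum>T\<in>Pow {..<M}. (\<Sum>s<M-1. (w s)\<^sup>2 * (of_bool (s \<in> T) - of_bool (Suc s \<in> T))) * (f T)\<^sup>2)"
    (is "?U = ?D + ?C")
proof -
  let ?I = "{..<M-1}" and ?O = "Pow {..<M}"
  have "?U = (\<Sum>T\<in>?O. \<Sum>s\<in>?I. \<Sum>t\<in>?I. raise_at w s f T * raise_at w t f T)"
    by (simp add: power2_eq_square sum_product)
  also have "\<dots> = (\<Sum>s\<in>?I. \<Sum>t\<in>?I. \<Sum>T\<in>?O. raise_at w s f T * raise_at w t f T)"
    by (subst sum.swap) (intro sum.cong refl sum.swap)
  also have "\<dots> = (\<Sum>s\<in>?I. \<Sum>t\<in>?I. \<Sum>T\<in>?O. f T * lower_at w s (raise_at w t f) T)"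
    by (intro sum.cong refl raise_at_adjoint) auto
  finally have U: "?U = \<dots>" .
  have "?D = (\<Sum>T\<in>?O. \<Sum>s\<in>?I. \<Sum>t\<in>?I. lower_at w s f T * lower_at w t f T)"
    by (simp add: power2_eq_square sum_product)
  also have "\<dots> = (\<Sum>s\<in>?I. \<Sum>t\<in>?I. \<Sum>T\<in>?O. lower_at w s f T * lower_at w t f T)"
    by (subst sum.swap) (intro sum.cong refl sum.swap)
  also have "\<dots> = (\<Sum>s\<in>?I. \<Sum>t\<in>?I. \<Sum>T\<in>?O. f T * raise_at w t (lower_at w s f) T)"
  proof (rule sum.cong[OF refl], rule sum.cong[OF refl])
    fix s t assume "t \<in> ?I"
    then have "Suc t < M" by auto
    from raise_at_adjoint[OF this, of w "lower_at w s f" f]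
    show "(\<Sum>T\<in>?O. lower_at w s f T * lower_at w t f T)
        = (\<Sum>T\<in>?O. f T * raise_at w t (lower_at w s f) T)"
      by (simp add: mult.commute)
  qed
  finally have D: "?D = \<dots>" .
  have "?U - ?D = (\<Sum>s\<in>?I. \<Sum>t\<in>?I. \<Sum>T\<in>?O.
      f T * lower_at w s (raise_at w t f) T - f T * raise_at w t (lower_at w s f) T)"
    unfolding U D by (simp only: sum_subtractf)
  also have "\<dots> = (\<Sum>s\<in>?I. \<Sum>t\<in>?I. if t = s then (\<Sum>T\<in>?O.
      (w s)\<^sup>2 * (of_bool (s \<in> T) - of_bool (Suc s \<in> T)) * (f T)\<^sup>2) else 0)"
  proof (intro sum.cong refl)
    fix s t
    show "(\<Sum>T\<in>?O. f T * lower_at w s (raise_at w t f) T - f T * raise_at w t (lower_at w s f) T)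
      = (if t = s then (\<Sum>T\<in>?O. (w s)\<^sup>2 * (of_bool (s \<in> T) - of_bool (Suc s \<in> T)) * (f T)\<^sup>2) else 0)"
      by (cases "t = s")
        (auto simp: raise_at_lower_at_commute raise_at_lower_at_same lower_at_raise_at_same
          power2_eq_square intro!: sum.cong)
  qed
  also have "\<dots> = (\<Sum>s\<in>?I. \<Sum>T\<in>?O. (w s)\<^sup>2 * (of_bool (s \<in> T) - of_bool (Suc s \<in> T)) * (f T)\<^sup>2)"
    by simp
  also have "\<dots> = ?C"
    by (subst sum.swap) (simp add: sum_distrib_right)
  finally show ?thesis by simp
qed

section \<open>Subsets of fixed size, graded by their sum\<close>

definition subsets_card_sum :: "nat \<Rightarrow> nat \<Rightarrow> nat \<Rightarrow> nat set set" where
  "subsets_card_sum M m j = {S. S \<subseteq> {..<M} \<and> card S = m \<and> \<Sum>S = j}"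

lemma finite_subsets_card_sum: "finite (subsets_card_sum M m j)"
  by (rule finite_subset[of _ "Pow {..<M}"]) (auto simp: subsets_card_sum_def)

text \<open>Shows that raising a function supported on sum \<open>j\<close> gives one supported on
  sum \<open>Suc j\<close>.\<close>

lemma subsets_card_sum_raise:
  assumes S: "insert s (T - {Suc s}) \<in> subsets_card_sum M m j"
    and T: "Suc s \<in> T" "s \<notin> T" "T \<subseteq> {..<M}"
  shows "T \<in> subsets_card_sum M m (Suc j)"
proof -
  have fin: "finite T" using T finite_subset by blast
  have "card T = Suc (card (T - {Suc s}))"
    using card.remove fin T by metis
  moreover have "\<Sum>T = Suc s + \<Sum>(T - {Suc s})"
    using sum.remove fin T by metis
  ultimately show ?thesis
    using S T fin by (auto simp: subsets_card_sum_def)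
qed

text \<open>Summation by parts: the squared weights are values of \<open>c s = s * (M - s)\<close>,
  whose increments are \<open>M - 1 - 2 * s\<close>.\<close>

lemma weight_sum:
  fixes T :: "nat set"
  assumes "T \<subseteq> {..<M}"
  shows "(\<Sum>s<M-1. real (Suc s) * real (M - Suc s) * (of_bool (s \<in> T) - of_bool (Suc s \<in> T)))
       = real (card T) * (real M - 1) - 2 * real (\<Sum>T)"
proof (cases M)
  case 0
  then show ?thesis using assms by simp
next
  case (Suc N)
  define c where "c s = real s * (real M - real s)" for s
  let ?b = "\<lambda>s. of_bool (s \<in> T) :: real"
  have "(\<Sum>s<M-1. real (Suc s) * real (M - Suc s) * (?b s - ?b (Suc s)))
      = (\<Sum>s<N. c (Suc s) * (?b s - ?b (Suc s)))"
    using Suc by (intro sum.cong) (auto simp: c_def of_nat_diff)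
  also have "\<dots> = (\<Sum>s<N. c (Suc s) * ?b s) - (\<Sum>s<N. c (Suc s) * ?b (Suc s))"
    by (simp add: algebra_simps sum_subtractf)
  \<comment> \<open>Since \<open>c M = 0\<close>, the last term can be added here;
    \<open>c 0 = 0\<close> supplies the first term in the next shift.\<close>
  also have "(\<Sum>s<N. c (Suc s) * ?b s) = (\<Sum>s<M. c (Suc s) * ?b s)"
    using Suc by (simp add: c_def)
  also have "(\<Sum>s<N. c (Suc s) * ?b (Suc s)) = (\<Sum>s<M. c s * ?b s)"
    unfolding Suc sum.lessThan_Suc_shift by (simp add: c_def)
  also have "(\<Sum>s<M. c (Suc s) * ?b s) - (\<Sum>s<M. c s * ?b s) = (\<Sum>s<M. (real M - 1 - 2 * real s) * ?b s)"
    unfolding sum_subtractf[symmetric] by (intro sum.cong refl) (auto simp: c_def algebra_simps)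
  also have "\<dots> = (\<Sum>s\<in>T. real M - 1 - 2 * real s)"
    by (rule sum.mono_neutral_cong_right) (use assms in auto)
  also have "\<dots> = real (card T) * (real M - 1) - 2 * real (\<Sum>T)"
    by (simp add: sum_subtractf sum_distrib_left)
  finally show ?thesis .
qed

text \<open>The hypothesis places \<open>j\<close> below the middle \<open>m * (M - 1) / 2\<close>.
  If the next level were smaller, raising would annihilate some nonzero \<open>f\<close>, against
  the norm identity.\<close>

lemma card_subsets_card_sum_mono:
  assumes "2 * j + m < m * M"
  shows "card (subsets_card_sum M m j) \<le> card (subsets_card_sum M m (Suc j))"
proof (rule ccontr)
  assume neg: "\<not> ?thesis"
  let ?A = "subsets_card_sum M m j" and ?B = "subsets_card_sum M m (Suc j)"
  define w where "w s = sqrt (real (Suc s) * real (M - Suc s))" for s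
  have w2: "(w s)\<^sup>2 = real (Suc s) * real (M - Suc s)" for s
    unfolding w_def by (intro real_sqrt_pow2) simp
  define L where "L T f = (\<Sum>s<M-1. raise_at w s f T)" for T f
  have "L T (\<lambda>x. f x + c * g x) = L T f + c * L T g" for T f g c
    unfolding L_def sum_distrib_left sum.distrib[symmetric]
    by (intro sum.cong refl) (auto simp: raise_at_def algebra_simps)
  from exists_nonzero_in_kernel[of ?B ?A L, OF finite_subsets_card_sum finite_subsets_card_sum _ this] neg
  obtain f where f: "\<exists>S\<in>?A. f S \<noteq> 0" "\<forall>S. S \<notin> ?A \<longrightarrow> f S = 0" "\<forall>T\<in>?B. L T f = 0"
    by auto
  have L0: "L T f = 0" if "T \<subseteq> {..<M}" for T
  proof (cases "T \<in> ?B")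
    case True
    then show ?thesis using f by blast
  next
    case False
    have "raise_at w s f T = 0" for s
      using subsets_card_sum_raise[of s T M m j] that False f(2)
      by (auto simp: raise_at_def)
    then show ?thesis by (simp add: L_def)
  qed
  \<comment> \<open>The value of \<open>weight_sum\<close> on sets of size \<open>m\<close> and sum
    \<open>j\<close>.\<close>
  define c where "c = real m * (real M - 1) - 2 * real j"
  have "c > 0"
  proof -
    have "real (2 * j + m) < real (m * M)" using assms by (simp only: of_nat_less_iff)
    then show ?thesis by (simp add: c_def algebra_simps)
  qed
  have "0 = (\<Sum>T\<in>Pow {..<M}. (L T f)\<^sup>2)" using L0 by (intro sum.neutral[symmetric]) auto
  also have "\<dots> = (\<Sum>T\<in>Pow {..<M}. (\<Sum>s<M-1. lower_at w s f T)\<^sup>2)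
     + (\<Sum>T\<in>Pow {..<M}. (\<Sum>s<M-1. (w s)\<^sup>2 * (of_bool (s \<in> T) - of_bool (Suc s \<in> T))) * (f T)\<^sup>2)"
    unfolding L_def by (rule norm_raise_minus_norm_lower)
  also have "(\<Sum>T\<in>Pow {..<M}. (\<Sum>s<M-1. (w s)\<^sup>2 * (of_bool (s \<in> T) - of_bool (Suc s \<in> T))) * (f T)\<^sup>2)
      = (\<Sum>T\<in>Pow {..<M}. c * (f T)\<^sup>2)"
  proof (intro sum.cong refl)
    fix T assume "T \<in> Pow {..<M}"
    then show "(\<Sum>s<M-1. (w s)\<^sup>2 * (of_bool (s \<in> T) - of_bool (Suc s \<in> T))) * (f T)\<^sup>2 = c * (f T)\<^sup>2"
      using weight_sum[of T M] f(2) by (cases "T \<in> ?A") (auto simp: w2 c_def subsets_card_sum_def)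
  qed
  finally have eq: "0 = (\<Sum>T\<in>Pow {..<M}. (\<Sum>s<M-1. lower_at w s f T)\<^sup>2) + (\<Sum>T\<in>Pow {..<M}. c * (f T)\<^sup>2)" .
  from f(1) obtain S where S: "S \<in> ?A" "f S \<noteq> 0" by auto
  then have "0 < (\<Sum>T\<in>Pow {..<M}. c * (f T)\<^sup>2)"
    using \<open>c > 0\<close> by (intro sum_pos2[of _ S]) (auto simp: subsets_card_sum_def)
  moreover have "0 \<le> (\<Sum>T\<in>Pow {..<M}. (\<Sum>s<M-1. lower_at w s f T)\<^sup>2)"
    by (intro sum_nonneg) auto
  ultimately show False using eq by linarith
qed

section \<open>Gaussian polynomials\<close>

text \<open>This form of the q-Pascal rule matches splitting subsets by their possible largest
  element \<open>M\<close>. Truncation in \<open>M - m\<close> is harmless, as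
  \<open>gauss_poly M m\<close> is zero for \<open>m > M\<close>.\<close>

fun gauss_poly :: "nat \<Rightarrow> nat \<Rightarrow> int poly" where
  "gauss_poly M 0 = 1"
| "gauss_poly 0 (Suc m) = 0"
| "gauss_poly (Suc M) (Suc m) = gauss_poly M (Suc m) + monom 1 (M - m) * gauss_poly M m"

definition qfact_poly :: "nat \<Rightarrow> int poly" where
  "qfact_poly M = (\<Prod>i = 1..M. 1 - monom 1 i)"

lemma qfact_poly_Suc: "qfact_poly (Suc M) = qfact_poly M * (1 - monom 1 (Suc M))"
  by (simp add: qfact_poly_def)

lemma gauss_poly_eq_0: "M < m \<Longrightarrow> gauss_poly M m = 0"
  by (induction M m rule: gauss_poly.induct) auto

text \<open>After extracting \<open>qfact_poly M\<close>, the Pascal rule amounts to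
  \<open>(1 - q^(M-m)) + q^(M-m) * (1 - q^(m+1)) = 1 - q^(M+1)\<close>.\<close>

lemma gauss_poly_qfact:
  "m \<le> M \<Longrightarrow> gauss_poly M m * qfact_poly m * qfact_poly (M - m) = qfact_poly M"
proof (induction M m rule: gauss_poly.induct)
  case (1 M)
  then show ?case by (simp add: qfact_poly_def)
next
  case (2 m)
  then show ?case by simp
next
  case (3 M m)
  have second: "gauss_poly M m * qfact_poly m * qfact_poly (M - m) = qfact_poly M"
    using 3 by simp
  have first: "gauss_poly M (Suc m) * qfact_poly (Suc m) * qfact_poly (M - m)
      = qfact_poly M * (1 - monom 1 (M - m))"
  proof (cases "m = M")
    case True
    then show ?thesis by (simp add: gauss_poly_eq_0)
  next
    case False
    then have *: "M - m = Suc (M - Suc m)" "Suc m \<le> M" using 3 by auto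
    show ?thesis unfolding "3.IH"(1)[OF *(2), symmetric] *(1) qfact_poly_Suc[of "M - Suc m"]
      by (simp only: ac_simps)
  qed
  have mon: "monom 1 (M - m) * monom 1 (Suc m) = (monom 1 (Suc M) :: int poly)"
    using 3 by (simp add: mult_monom)
  have "gauss_poly (Suc M) (Suc m) * qfact_poly (Suc m) * qfact_poly (Suc M - Suc m)
      = gauss_poly M (Suc m) * qfact_poly (Suc m) * qfact_poly (M - m)
      + monom 1 (M - m) * (1 - monom 1 (Suc m)) * (gauss_poly M m * qfact_poly m * qfact_poly (M - m))"
    by (simp only: gauss_poly.simps diff_Suc_Suc qfact_poly_Suc[of m]) (simp only: algebra_simps)
  also have "\<dots> = qfact_poly M * (1 - monom 1 (M - m) * monom 1 (Suc m))"
    unfolding first second by (simp only: algebra_simps)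
  also have "\<dots> = qfact_poly (Suc M)"
    unfolding mon qfact_poly_Suc ..
  finally show ?case .
qed

text \<open>The shift \<open>m * (m - 1) div 2\<close> is the least possible sum,
  \<open>0 + ... + (m - 1)\<close>.\<close>

lemma gauss_poly_generating_function:
  "monom 1 (m * (m - 1) div 2) * gauss_poly M m
     = (\<Sum>S | S \<subseteq> {..<M} \<and> card S = m. monom 1 (\<Sum>S))"
proof (induction M m rule: gauss_poly.induct)
  case (1 M)
  have "{S. S \<subseteq> {..<M} \<and> card S = 0} = {{}}" by (auto simp: card_eq_0_iff dest: finite_subset)
  then show ?case by simp
next
  case (2 m)
  then show ?case by auto
next
  case (3 M m)
  let ?c = "\<lambda>m::nat. m * (m - 1) div 2"
  let ?A = "\<lambda>(M::nat) m. {S. S \<subseteq> {..<M} \<and> card S = m}"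
  let ?f = "\<lambda>S. monom 1 (\<Sum>S) :: int poly"
  have c: "?c (Suc m) = ?c m + m" by (cases m) (auto simp: algebra_simps)
  have fin: "finite (?A M m)" for M m by (rule finite_subset[of _ "Pow {..<M}"]) auto
  have split: "?A (Suc M) (Suc m) = ?A M (Suc m) \<union> insert M ` ?A M m"
  proof (intro equalityI subsetI)
    fix S assume S: "S \<in> ?A (Suc M) (Suc m)"
    then have "finite S" using finite_subset by blast
    show "S \<in> ?A M (Suc m) \<union> insert M ` ?A M m"
    proof (cases "M \<in> S")
      case True
      then have "S = insert M (S - {M})" "S - {M} \<in> ?A M m"
        using S \<open>finite S\<close> by (auto simp: less_Suc_eq)
      then show ?thesis by blast
    next
      case False
      then have "S \<subseteq> {..<M}" using S by (auto simp: less_Suc_eq subset_iff)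
      then show ?thesis using S by simp
    qed
  next
    fix S assume "S \<in> ?A M (Suc m) \<union> insert M ` ?A M m"
    then show "S \<in> ?A (Suc M) (Suc m)"
    proof
      assume "S \<in> insert M ` ?A M m"
      then obtain R where R: "S = insert M R" "R \<subseteq> {..<M}" "card R = m" by auto
      then have "finite R" "M \<notin> R" using finite_subset by auto
      then show ?thesis using R by (auto simp: less_Suc_eq)
    qed (auto simp: less_Suc_eq)
  qed
  have inj: "inj_on (insert M) (?A M m)"
    by (rule inj_onI) (metis (no_types, lifting) insert_ident lessThan_iff less_irrefl mem_Collect_eq subsetD)
  have "sum ?f (?A (Suc M) (Suc m)) = sum ?f (?A M (Suc m)) + sum ?f (insert M ` ?A M m)"
    unfolding split by (rule sum.union_disjoint) (use fin in auto)
  also have "sum ?f (insert M ` ?A M m) = (\<Sum>S\<in>?A M m. monom 1 M * ?f S)"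
    unfolding sum.reindex[OF inj]
  proof (intro sum.cong refl)
    fix S assume "S \<in> ?A M m"
    then have "finite S" "M \<notin> S" using finite_subset by auto
    then show "(?f \<circ> insert M) S = monom 1 M * ?f S" by (simp add: mult_monom)
  qed
  also have "\<dots> = monom 1 M * (monom 1 (?c m) * gauss_poly M m)"
    unfolding "3.IH"(2) by (simp add: sum_distrib_left)
  also have "\<dots> = monom 1 (?c (Suc m)) * (monom 1 (M - m) * gauss_poly M m)"
  proof (cases "m \<le> M")
    case True
    then show ?thesis unfolding c by (simp add: mult_monom mult.assoc[symmetric] add.commute)
  qed (simp add: gauss_poly_eq_0)
  also have "sum ?f (?A M (Suc m)) = monom 1 (?c (Suc m)) * gauss_poly M (Suc m)"
    using "3.IH"(1) by simp
  finally show ?case by (simp only: gauss_poly.simps distrib_left)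
qed

lemma coeff_gauss_poly:
  "coeff (gauss_poly M m) i = int (card (subsets_card_sum M m (i + m * (m - 1) div 2)))"
proof -
  let ?c = "m * (m - 1) div 2"
  let ?A = "{S. S \<subseteq> {..<M} \<and> card S = m}"
  have fin: "finite ?A" by (rule finite_subset[of _ "Pow {..<M}"]) auto
  have "coeff (gauss_poly M m) i = coeff (monom 1 ?c * gauss_poly M m) (i + ?c)"
    by (simp add: coeff_monom_mult)
  also have "\<dots> = (\<Sum>S\<in>?A. if \<Sum>S = i + ?c then 1 else 0)"
    unfolding gauss_poly_generating_function coeff_sum by (simp add: eq_commute)
  also have "\<dots> = (\<Sum>S\<in>subsets_card_sum M m (i + ?c). 1)"
    by (rule sum.mono_neutral_cong_right) (auto simp: fin subsets_card_sum_def)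
  finally show ?thesis by simp
qed

lemma gauss_poly_coeff_nonneg: "0 \<le> coeff (gauss_poly M m) i"
  by (simp add: coeff_gauss_poly)

text \<open>Adding the least sum to \<open>i\<close> turns the bound into that of
  \<open>card_subsets_card_sum_mono\<close>.\<close>

lemma gauss_poly_coeff_Suc_mono:
  assumes "2 * i < m * (M - m)" and "m \<le> M"
  shows "coeff (gauss_poly M m) i \<le> coeff (gauss_poly M m) (Suc i)"
proof -
  have "2 * (m * (m - 1) div 2) = m * (m - 1)"
    by (intro dvd_mult_div_cancel) auto
  moreover have "m * (M - m) + m * (m - 1) + m = m * M"
    using le_Suc_ex[OF assms(2)] by (cases m) (auto simp: algebra_simps)
  ultimately have "2 * (i + m * (m - 1) div 2) + m < m * M"
    using assms(1) unfolding distrib_left by linarith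
  from card_subsets_card_sum_mono[OF this] show ?thesis by (simp add: coeff_gauss_poly)
qed

section \<open>Degrees and palindromicity\<close>

lemma degree_one_minus_monom: "degree (1 - monom 1 n :: int poly) = n"
proof (cases "n = 0")
  case False
  then have "degree (1 :: int poly) < degree (monom 1 n :: int poly)"
    by (simp add: degree_monom_eq)
  from degree_add_eq_right[of 1 "- monom 1 n :: int poly"] this show ?thesis
    by (simp add: degree_monom_eq)
qed (simp add: monom_0 flip: one_pCons)

lemma one_minus_monom_neq_0: "n > 0 \<Longrightarrow> (1 - monom 1 n :: int poly) \<noteq> 0"
  using degree_one_minus_monom[of n] by fastforce

lemma reflect_one_minus_monom:
  "n > 0 \<Longrightarrow> reflect_poly (1 - monom 1 n :: int poly) = - (1 - monom 1 n)"
  by (rule poly_eqI) (auto simp: coeff_reflect_poly degree_one_minus_monom)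

lemma qfact_poly_neq_0: "qfact_poly M \<noteq> 0"
  by (auto simp: qfact_poly_def monom_eq_1_iff)

lemma reflect_qfact_poly: "reflect_poly (qfact_poly M) = (-1) ^ M * qfact_poly M"
proof (induction M)
  case 0
  then show ?case by (simp add: qfact_poly_def)
next
  case (Suc M)
  then show ?case
    unfolding qfact_poly_Suc reflect_poly_mult by (simp add: reflect_one_minus_monom algebra_simps)
qed

lemma degree_qfact_poly: "2 * degree (qfact_poly M) = M * (M + 1)"
proof (induction M)
  case 0
  then show ?case by (simp add: qfact_poly_def)
next
  case (Suc M)
  then show ?case
    by (simp add: qfact_poly_Suc degree_mult_eq qfact_poly_neq_0 monom_eq_1_iff
        degree_one_minus_monom)
qed

lemma gauss_poly_neq_0: "m \<le> M \<Longrightarrow> gauss_poly M m \<noteq> 0"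
  using gauss_poly_qfact[of m M] qfact_poly_neq_0[of M] by auto

lemma degree_gauss_poly:
  assumes "m \<le> M"
  shows "degree (gauss_poly M m) = m * (M - m)"
proof -
  obtain l where M: "M = m + l" using assms le_Suc_ex by blast
  have "degree (gauss_poly M m) + degree (qfact_poly m) + degree (qfact_poly (M - m))
      = degree (qfact_poly M)"
    unfolding gauss_poly_qfact[OF assms, symmetric]
    by (simp add: degree_mult_eq qfact_poly_neq_0 gauss_poly_neq_0 assms)
  then have "2 * degree (gauss_poly M m) + m * (m + 1) + l * (l + 1) = M * (M + 1)"
    using degree_qfact_poly[of m] degree_qfact_poly[of M] degree_qfact_poly[of l] M by simp
  then show ?thesis unfolding M by (simp add: algebra_simps)
qed

text \<open>Reversal is multiplicative and flips the sign of each factor \<open>1 - q^i\<close>;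
  these signs cancel in the product formula.\<close>

lemma reflect_gauss_poly:
  assumes "m \<le> M"
  shows "reflect_poly (gauss_poly M m) = gauss_poly M m"
proof -
  have "reflect_poly (gauss_poly M m) * ((-1) ^ m * qfact_poly m) * ((-1) ^ (M - m) * qfact_poly (M - m))
     = (-1) ^ M * qfact_poly M"
    using arg_cong[OF gauss_poly_qfact[OF assms], of reflect_poly]
    unfolding reflect_poly_mult reflect_qfact_poly .
  also have "\<dots> = (-1) ^ m * (-1) ^ (M - m) * (gauss_poly M m * qfact_poly m * qfact_poly (M - m))"
    unfolding gauss_poly_qfact[OF assms] power_add[symmetric] using assms by simp
  finally have "(reflect_poly (gauss_poly M m) - gauss_poly M m)
      * ((-1) ^ m * (-1) ^ (M - m) * qfact_poly m * qfact_poly (M - m)) = 0"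
    by (simp add: algebra_simps)
  then show ?thesis by (simp add: qfact_poly_neq_0)
qed

lemma reflect_poly_eq_self_coeff:
  assumes "reflect_poly p = p" and "i \<le> degree p"
  shows "coeff p (degree p - i) = coeff p i"
  using arg_cong[OF assms(1), of "\<lambda>p. coeff p i"] assms(2) by (simp add: coeff_reflect_poly)

text \<open>The bounds say that \<open>a\<close> is at least as far from the centre as
  \<open>b\<close>, so unimodality and symmetry combine into one inequality.\<close>

lemma gauss_poly_coeff_mono:
  assumes "m \<le> M" and "a \<le> b" and "a + b \<le> m * (M - m)"
  shows "coeff (gauss_poly M m) a \<le> coeff (gauss_poly M m) b"
proof -
  let ?N = "m * (M - m)" and ?p = "coeff (gauss_poly M m)"
  have half: "?p a \<le> ?p b" if "a \<le> b" "2 * b \<le> ?N" for b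
    using that
  proof (induction b rule: dec_induct)
    case (step b)
    then show ?case using gauss_poly_coeff_Suc_mono[of b m M] assms(1) by simp
  qed simp
  show ?thesis
  proof (cases "2 * b \<le> ?N")
    case True
    then show ?thesis using half assms by blast
  next
    case False
    \<comment> \<open>The mirror image of \<open>b\<close> lies in the first half and is still at
      least \<open>a\<close>.\<close>
    have "?p a \<le> ?p (?N - b)" by (rule half) (use assms False in linarith)+
    also have "\<dots> = ?p b"
      using reflect_poly_eq_self_coeff[OF reflect_gauss_poly[OF assms(1)], of b] assms
      by (simp add: degree_gauss_poly)
    finally show ?thesis .
  qed
qed

section \<open>The quotients\<close>

lemma coeff_one_minus_monom_mult:
  fixes p :: "int poly"
  shows "coeff ((1 - monom 1 n) * p) i = coeff p i - (if n \<le> i then coeff p (i - n) else 0)"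
  by (simp add: left_diff_distrib coeff_monom_mult)

lemma gauss_poly_quotient_nonneg:
  assumes "m \<le> M" and "e > 0" and "n > 0"
    and A: "(1 - monom 1 n) * A = (1 - monom 1 e) * gauss_poly M m"
  shows "0 \<le> coeff A i"
proof -
  let ?p = "coeff (gauss_poly M m)"
  define N where "N = m * (M - m)"
  have rec: "coeff A i = (if n \<le> i then coeff A (i - n) else 0) + ?p i - (if e \<le> i then ?p (i - e) else 0)" for i
    using arg_cong[OF A, of "\<lambda>p. coeff p i"] unfolding coeff_one_minus_monom_mult by linarith
  \<comment> \<open>The bound is what makes \<open>(i - e) + i \<le> N\<close>, so that
    \<open>?p (i - e) \<le> ?p i\<close>.\<close>
  have low: "2 * i \<le> N + e \<Longrightarrow> 0 \<le> coeff A i" for i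
  proof (induction i rule: less_induct)
    case (less i)
    have "0 \<le> (if n \<le> i then coeff A (i - n) else 0)"
      using less.IH[of "i - n"] less.prems \<open>n > 0\<close> by auto
    moreover have "(if e \<le> i then ?p (i - e) else 0) \<le> ?p i"
      using gauss_poly_coeff_mono[OF \<open>m \<le> M\<close>, of "i - e" i] less.prems gauss_poly_coeff_nonneg
      by (auto simp: N_def)
    ultimately show ?case unfolding rec[of i] by linarith
  qed
  have "A \<noteq> 0"
    using A gauss_poly_neq_0[OF assms(1)] one_minus_monom_neq_0[OF \<open>e > 0\<close>] by auto
  then have deg: "n + degree A = e + N"
    using arg_cong[OF A, of degree] assms(1-3)
    by (simp add: degree_mult_eq monom_eq_1_iff gauss_poly_neq_0 degree_one_minus_monom
        degree_gauss_poly N_def)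
  \<comment> \<open>Reversing the defining equation of \<open>A\<close> flips the sign on both
    sides, so \<open>A\<close> is palindromic.\<close>
  have "- (1 - monom 1 n) * reflect_poly A = - (1 - monom 1 e) * gauss_poly M m"
    using arg_cong[OF A, of reflect_poly] assms(1-3)
    by (simp only: reflect_poly_mult reflect_one_minus_monom reflect_gauss_poly)
  also have "\<dots> = - (1 - monom 1 n) * A" using A by (simp only: mult_minus_left)
  finally have refl: "reflect_poly A = A"
    using one_minus_monom_neq_0[OF \<open>n > 0\<close>] by (simp add: monom_eq_1_iff)
  show ?thesis
  proof (cases "2 * i \<le> N + e \<or> i > degree A")
    case True
    then show ?thesis using low by (auto simp: coeff_eq_0)
  next
    case False
    \<comment> \<open>By \<open>deg\<close>, the mirror index is \<open>N + e - n - i\<close>, which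
      is in the range of \<open>low\<close> when \<open>2 * i > N + e\<close>.\<close>
    then have "0 \<le> coeff A (degree A - i)" using deg by (intro low) linarith
    then show ?thesis using reflect_poly_eq_self_coeff[OF refl, of i] False by simp
  qed
qed

section \<open>Divisibility by \<open>1 - q^n\<close>\<close>

lemma one_minus_monom_dvd:
  fixes a b :: nat
  shows "(1 - monom 1 a :: int poly) dvd 1 - monom 1 (a * b)"
proof (induction b)
  case (Suc b)
  have "(1 - monom 1 (a * Suc b) :: int poly) = (1 - monom 1 a) + monom 1 a * (1 - monom 1 (a * b))"
    by (simp add: right_diff_distrib mult_monom)
  then show ?case using Suc by (metis dvd_add dvd_mult dvd_refl)
qed (simp add: monom_0 flip: one_pCons)

text \<open>The quotient is the difference \<open>?B\<close> of Gaussian polynomials, checked after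
  multiplication by \<open>?F (Suc j) * ?F (n + k)\<close>. For \<open>k = n\<close> the factor
  \<open>1 - q^k\<close> is itself the divisor.\<close>

lemma gauss_poly_divisible:
  assumes "0 < k" and "k \<le> n"
  shows "(1 - monom 1 n) dvd (1 - monom 1 k) * gauss_poly (2 * n) (n - k)"
proof (cases "k = n")
  case False
  define j where "j = n - Suc k"
  have j: "n - k = Suc j" "2 * n - (n - k) = Suc (n + k - 1)" "2 * n - 1 - Suc j = n + k - 1"
    "2 * n - 1 - j = Suc (n + k - 1)" "2 * n = Suc (2 * n - 1)" "Suc (n + k - 1) = n + k"
    using assms False by (auto simp: j_def)
  let ?X = "\<lambda>i. monom 1 i :: int poly" and ?F = qfact_poly
  let ?B = "gauss_poly (2 * n - 1) (Suc j) - ?X k * gauss_poly (2 * n - 1) j"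
  have g0: "gauss_poly (2 * n) (n - k) * ?F (Suc j) * ?F (n + k) = ?F (2 * n - 1) * (1 - ?X (2 * n))"
    using gauss_poly_qfact[of "n - k" "2 * n"] j qfact_poly_Suc[of "2 * n - 1"] by simp
  have "gauss_poly (2 * n - 1) (Suc j) * ?F (Suc j) * ?F (n + k - 1) = ?F (2 * n - 1)"
    using gauss_poly_qfact[of "Suc j" "2 * n - 1"] j by simp
  then have g1: "gauss_poly (2 * n - 1) (Suc j) * ?F (Suc j) * ?F (n + k) = ?F (2 * n - 1) * (1 - ?X (n + k))"
    using qfact_poly_Suc[of "n + k - 1"] j by (simp add: mult.assoc[symmetric])
  have "gauss_poly (2 * n - 1) j * ?F j * ?F (n + k) = ?F (2 * n - 1)"
    using gauss_poly_qfact[of j "2 * n - 1"] j by simp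
  then have g2: "gauss_poly (2 * n - 1) j * ?F (Suc j) * ?F (n + k) = ?F (2 * n - 1) * (1 - ?X (n - k))"
    unfolding qfact_poly_Suc[of j] j(1) by (simp add: algebra_simps)
  have X: "?X k * ?X (n - k) = ?X n" "?X (n + k) = ?X n * ?X k" "?X (2 * n) = ?X n * ?X n"
    using assms by (auto simp: mult_monom mult_2)
  have "?B * (?F (Suc j) * ?F (n + k))
      = gauss_poly (2 * n - 1) (Suc j) * ?F (Suc j) * ?F (n + k)
      - ?X k * (gauss_poly (2 * n - 1) j * ?F (Suc j) * ?F (n + k))"
    by (simp only: algebra_simps)
  also have "\<dots> = ?F (2 * n - 1) * (1 - ?X (n + k) - (?X k - ?X k * ?X (n - k)))"
    unfolding g1 g2 by (simp only: algebra_simps)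
  \<comment> \<open>The factor \<open>1 + q^n\<close> will combine with \<open>1 - q^n\<close> into
    \<open>1 - q^(2n)\<close>, the last factor of \<open>?F (2 * n)\<close>.\<close>
  also have "\<dots> = ?F (2 * n - 1) * ((1 - ?X k) * (1 + ?X n))"
    unfolding X by (simp add: algebra_simps)
  finally have B: "?B * (?F (Suc j) * ?F (n + k)) = ?F (2 * n - 1) * ((1 - ?X k) * (1 + ?X n))" .
  have "(1 - ?X n) * ?B * (?F (Suc j) * ?F (n + k))
      = (1 - ?X k) * (?F (2 * n - 1) * (1 - ?X n * ?X n))"
    unfolding mult.assoc B by (simp add: algebra_simps)
  also have "\<dots> = (1 - ?X k) * gauss_poly (2 * n) (n - k) * (?F (Suc j) * ?F (n + k))"
    unfolding X(3)[symmetric] g0[symmetric] by (simp only: ac_simps)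
  finally have "(1 - ?X n) * ?B = (1 - ?X k) * gauss_poly (2 * n) (n - k)"
    using qfact_poly_neq_0 by simp
  then show ?thesis by (metis dvd_triv_left)
qed simp

lemma gauss_poly_gcd_divisible:
  assumes "0 < k" and "k \<le> n"
  shows "(1 - monom 1 n) dvd (1 - monom 1 (gcd k n)) * gauss_poly (2 * n) (n - k)"
proof -
  let ?X = "\<lambda>i. monom 1 i :: int poly" and ?p = "gauss_poly (2 * n) (n - k)"
  obtain x y where xy: "k * x = n * y + gcd k n"
    using bezout_nat[of k n] assms by auto
  have "(1 - ?X n) dvd (1 - ?X (k * x)) * ?p"
    using gauss_poly_divisible[OF assms] one_minus_monom_dvd[of k x]
    by (meson dvd_trans dvd_refl mult_dvd_mono)
  moreover have "(1 - ?X n) dvd (1 - ?X (n * y)) * (?X (gcd k n) * ?p)"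
    using one_minus_monom_dvd[of n y] by (rule dvd_mult2)
  \<comment> \<open>With \<open>g = gcd k n\<close> and \<open>k * x = n * y + g\<close>, this is
    \<open>1 - q^g = (1 - q^(k*x)) - q^g * (1 - q^(n*y))\<close>.\<close>
  moreover have "(1 - ?X (gcd k n)) * ?p
      = (1 - ?X (k * x)) * ?p - (1 - ?X (n * y)) * (?X (gcd k n) * ?p)"
    unfolding xy by (simp add: algebra_simps mult_monom flip: mult.assoc)
  ultimately show ?thesis by (metis dvd_diff)
qed

section \<open>Transfer to the field of fractions\<close>

lemma qvar_power: "qvar ^ i = to_fract (monom 1 i)"
proof (induction i)
  case (Suc i)
  then show ?case by (simp add: qvar_def monom_Suc flip: to_fract_mult)
qed (simp add: monom_0 flip: one_pCons)

lemma one_minus_qvar_power: "1 - qvar ^ i = to_fract (1 - monom 1 i)"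
  by (simp add: qvar_power)

lemma prod_qvar: "(\<Prod>i = 1..n. 1 - qvar ^ i) = to_fract (qfact_poly n)"
proof (induction n)
  case (Suc n)
  then show ?case by (simp add: qfact_poly_Suc one_minus_qvar_power del: to_fract_diff)
qed (simp add: qfact_poly_def)

lemma qbinomial_eq_gauss_poly:
  assumes "m \<le> M"
  shows "qbinomial M m = to_fract (gauss_poly M m)"
  unfolding qbinomial_def prod_qvar gauss_poly_qfact[OF assms, symmetric]
  using assms by (simp add: qfact_poly_neq_0 field_simps)

lemma nonneg_quotient:
  assumes "0 < e" and "0 < n"
    and "(1 - monom 1 n) dvd (1 - monom 1 e) * gauss_poly (2 * n) (n - k)"
  shows "nonneg_int_polynomial ((1 - qvar ^ e) / (1 - qvar ^ n) * qbinomial (2 * n) (n - k))"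
proof -
  obtain A where A: "(1 - monom 1 n) * A = (1 - monom 1 e) * gauss_poly (2 * n) (n - k)"
    using assms(3) by (metis dvdE)
  have "\<forall>i. 0 \<le> coeff A i"
    using gauss_poly_quotient_nonneg[OF _ assms(1,2) A] by simp
  moreover have "to_fract (1 - monom 1 n) * to_fract A
      = to_fract (1 - monom 1 e) * to_fract (gauss_poly (2 * n) (n - k))"
    unfolding to_fract_mult[symmetric] A ..
  then have "(1 - qvar ^ e) / (1 - qvar ^ n) * qbinomial (2 * n) (n - k) = to_fract A"
    using one_minus_monom_neq_0[OF assms(2)]
    by (simp add: one_minus_qvar_power qbinomial_eq_gauss_poly field_simps del: to_fract_diff)
  ultimately show ?thesis unfolding nonneg_int_polynomial_def by blast
qed

lemma nonneg_int_polynomial_0: "nonneg_int_polynomial 0"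
  unfolding nonneg_int_polynomial_def by (intro exI[of _ 0]) simp

theorem theorem3p2:
  fixes n k :: nat
  assumes "k \<le> n"
  shows "nonneg_int_polynomial
           ((1 - qvar ^ gcd k n) / (1 - qvar ^ n) * qbinomial (2 * n) (n - k))
       \<and> nonneg_int_polynomial (qB n k)"
proof (cases "k = 0")
  case True
  \<comment> \<open>Here \<open>gcd 0 n = n\<close>, so for \<open>n > 0\<close> the first claim
    needs only trivial divisibility, while \<open>qB n 0\<close> is zero because its numerator
    contains \<open>1 - q^0\<close>.\<close>
  show ?thesis
  proof (cases "n = 0")
    case False
    then show ?thesis
      using True nonneg_quotient[of n n 0] by (simp add: qB_def nonneg_int_polynomial_0)
  \<comment> \<open>For \<open>n = 0\<close> both fractions are \<open>0 / 0\<close>, which is zero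
    in the field.\<close>
  qed (simp add: True qB_def nonneg_int_polynomial_0)
next
  case False
  then show ?thesis
    using assms nonneg_quotient[OF _ _ gauss_poly_gcd_divisible]
      nonneg_quotient[OF _ _ gauss_poly_divisible] by (simp add: qB_def)
qed

end
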